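(* Let $G$ be a finite non-abelian group, $H$ a subgroup of $G$ with $H \neq Z(H,G)$, and $g \in K(H,G)$. If $g \in H \setminus Z(H,G)$ and $o(g) \neq 3$, then $\operatorname{diam}(\Delta_{H,G}^g) \leq 3$.
   Context: For a subgroup $H$ of a finite non-abelian group $G$, write $[x,y] = x^{-1}y^{-1}xy$, $Z(H,G) = \{x \in H : xy = yx \text{ for all } y \in G\}$ and $K(H,G) = \{[x,y] : x \in H,\ y \in G\}$. For $g \in G$, $\Delta_{H,G}^g$ is the simple graph with vertex set $G \setminus Z(H,G)$ in which two distinct vertices $x,y$ are adjacent if and only if ($x \in H$ or $y \in H$) and $[x,y] \neq g$ and $[x,y] \neq g^{-1}$. $o(g)$ is the order of $g$, and $\operatorname{diam}$ denotes the diameter of a graph (in particular, finite diameter means the graph is connected). *)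

theory Defs
  imports "HOL-Algebra.Algebra" "Graph_Theory.Graph_Theory"
begin

definition commutator :: "('a, 'b) monoid_scheme \<Rightarrow> 'a \<Rightarrow> 'a \<Rightarrow> 'a" where
  "commutator G x y = inv\<^bsub>G\<^esub> x \<otimes>\<^bsub>G\<^esub> inv\<^bsub>G\<^esub> y \<otimes>\<^bsub>G\<^esub> x \<otimes>\<^bsub>G\<^esub> y"

text \<open>\<open>rel_center H G\<close> is $Z(H,G)$ and \<open>rel_commutators H G\<close> is $K(H,G)$; the latter is
  the plain set of commutators, not the subgroup it generates.\<close>

definition rel_center :: "'a set \<Rightarrow> ('a, 'b) monoid_scheme \<Rightarrow> 'a set" where
  "rel_center H G = {x \<in> H. \<forall>y \<in> carrier G. x \<otimes>\<^bsub>G\<^esub> y = y \<otimes>\<^bsub>G\<^esub> x}"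

definition rel_commutators :: "'a set \<Rightarrow> ('a, 'b) monoid_scheme \<Rightarrow> 'a set" where
  "rel_commutators H G = {commutator G x y | x y. x \<in> H \<and> y \<in> carrier G}"

text \<open>The graph $\Delta_{H,G}^g$. As usual in \<open>Graph_Theory\<close>, an undirected edge is represented by
  the two opposite arcs; lemma \<open>pair_graph_Delta\<close> below shows that the result is a simple graph.\<close>

definition Delta :: "'a set \<Rightarrow> ('a, 'b) monoid_scheme \<Rightarrow> 'a \<Rightarrow> 'a pair_pre_digraph" where
  "Delta H G g =
    \<lparr> pverts = carrier G - rel_center H G,
      parcs = {(x, y). x \<in> carrier G - rel_center H G \<and> y \<in> carrier G - rel_center H G \<and> x \<noteq> y
        \<and> (x \<in> H \<or> y \<in> H) \<and> commutator G x y \<noteq> g \<and> commutator G x y \<noteq> inv\<^bsub>G\<^esub> g} \<rparr>"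

text \<open>The distance is \<open>\<mu>\<close> with unit weights, i.e. the least number of arcs of a walk, and
  \<open>\<infinity>\<close> if there is none. Hence a diameter below \<open>\<infinity>\<close> entails connectedness.\<close>

definition diameter :: "('a, 'b) pre_digraph \<Rightarrow> ereal" where
  "diameter D = (SUP u \<in> verts D. SUP v \<in> verts D. wf_digraph.\<mu> D (\<lambda>_. 1) u v)"

lemma (in group) inv_commutator:
  assumes "x \<in> carrier G" "y \<in> carrier G"
  shows "inv (commutator G x y) = commutator G y x"
  using assms by (simp add: commutator_def inv_mult_group m_assoc)

lemma (in group) pair_graph_Delta:
  assumes "finite (carrier G)" "g \<in> carrier G"
  shows "pair_graph (Delta H G g)"
proof -
  have comm_closed: "commutator G x y \<in> carrier G"
    if "x \<in> carrier G" "y \<in> carrier G" for x y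
    using that by (simp add: commutator_def)
  have flip: "commutator G y x = h \<longleftrightarrow> commutator G x y = inv h"
    if "x \<in> carrier G" "y \<in> carrier G" "h \<in> carrier G" for x y h
    using that inv_commutator[of x y] comm_closed[of x y] by (metis inv_inv)
  have "sym (parcs (Delta H G g))"
    using assms(2) by (auto simp: sym_def Delta_def flip)
  moreover have "finite (parcs (Delta H G g))"
    by (rule finite_subset[of _ "carrier G \<times> carrier G"]) (auto simp: Delta_def assms(1))
  ultimately show ?thesis
    by unfold_locales (auto simp: Delta_def assms(1) Digraph.symmetric_def)
qed

end

theory Submission
  imports Defs
begin

text \<open>
  The element \<open>g\<close> is itself a vertex of the graph and almost a universal one. Since
  \<open>g \<noteq> \<one>\<close>, the commutator \<open>[x, g]\<close> is never \<open>g\<close>, and it is \<open>g\<inverse>\<close> precisely when \<open>x\<close>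
  conjugates \<open>g\<close> to \<open>g\<^sup>2\<close>, i.e. \<open>g x = x g\<^sup>2\<close>; so \<open>g\<close> is adjacent to every other vertex
  that does not do this. Suppose that \<open>x\<close> does conjugate \<open>g\<close> to \<open>g\<^sup>2\<close>. Then \<open>g\<^sup>2\<close> is not
  central, because \<open>g\<close> is not, and \<open>x\<close> conjugates \<open>g\<^sup>2\<close> to \<open>g\<^sup>4\<close>. The commutator \<open>[x, g\<^sup>2]\<close>
  is therefore \<open>g\<^sup>-\<^sup>2\<close>, which differs from \<open>g\<close> because the order of \<open>g\<close> is neither 1 nor 3,
  and from \<open>g\<inverse>\<close> because \<open>g \<noteq> \<one>\<close>. So \<open>x\<close> is adjacent to \<open>g\<^sup>2\<close>.

  Every vertex is thus within one step of \<open>g\<close> or of \<open>g\<^sup>2\<close>, and in the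
  case that calls for \<open>g\<^sup>2\<close>, that element is a vertex. It is then adjacent to \<open>g\<close>, since
  the two commute. So a path between two vertices needs at most one step at either end and
  the edge between \<open>g\<close> and \<open>g\<^sup>2\<close> in the middle.
\<close>

definition eq_or_arc :: "'a pair_pre_digraph \<Rightarrow> 'a \<Rightarrow> 'a \<Rightarrow> bool" where
  "eq_or_arc D x y \<longleftrightarrow> x = y \<or> (x, y) \<in> parcs D"

lemma (in pair_wf_digraph) awalk_of_eq_or_arc:
  assumes "eq_or_arc G x y" "y \<in> pverts G"
  obtains p where "awalk x p y" "length p \<le> 1"
proof (cases "x = y")
  case True
  with assms(2) have "awalk x [] y" by (simp add: awalk_Nil_iff)
  then show ?thesis using that by fastforce
next
  case False
  with assms(1) have "(x, y) \<in> parcs G" by (simp add: eq_or_arc_def)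
  then have "awalk x [(x, y)] y"
    by (simp add: awalk_Cons_iff awalk_Nil_iff assms(2) in_arcsD1)
  then show ?thesis using that by fastforce
qed

lemma (in pair_wf_digraph) distance_le_3:
  assumes "eq_or_arc G u a" "eq_or_arc G a b" "eq_or_arc G b v"
    and "a \<in> pverts G" "b \<in> pverts G" "v \<in> pverts G"
  shows "\<mu> (\<lambda>_. 1) u v \<le> 3"
proof -
  obtain p q r where walks: "awalk u p a" "awalk a q b" "awalk b r v"
    and lengths: "length p \<le> 1" "length q \<le> 1" "length r \<le> 1"
    using assms awalk_of_eq_or_arc by metis
  have "awalk u (p @ q @ r) v"
    using walks by (auto intro: awalk_appendI)
  then have "\<mu> (\<lambda>_. 1) u v \<le> awalk_cost (\<lambda>_. 1) (p @ q @ r)"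
    by (rule min_cost_le_walk_cost)
  also have "awalk_cost (\<lambda>_. 1) (p @ q @ r) = real (length (p @ q @ r))"
    by (simp add: awalk_cost_def sum_list_triv)
  also have "ereal (real (length (p @ q @ r))) \<le> 3"
    using lengths by simp
  finally show ?thesis .
qed

context group
begin

lemma commutator_eq_iff:
  assumes "x \<in> carrier G" "y \<in> carrier G" "c \<in> carrier G"
  shows "commutator G x y = c \<longleftrightarrow> x \<otimes> y = y \<otimes> (x \<otimes> c)"
proof -
  have "commutator G x y = inv (y \<otimes> x) \<otimes> (x \<otimes> y)"
    using assms by (simp add: commutator_def inv_mult_group m_assoc)
  then show ?thesis
    using assms by (metis inv_solve_left m_assoc m_closed)
qed

text \<open>The only obstruction to an edge between \<open>x\<close> and \<open>g\<close> is that \<open>x\<close> conjugates \<open>g\<close> to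
  \<open>g\<^sup>2\<close>: the equation \<open>[x, g] = g\<close> cancels to \<open>g = \<one>\<close>, and \<open>[x, g] = g\<inverse>\<close> to
  \<open>g x = x g\<^sup>2\<close>.\<close>

lemma eq_or_arc_Delta_self:
  assumes "subgroup H G" "g \<in> H - rel_center H G" "x \<in> carrier G - rel_center H G"
    and no_square: "g \<otimes> x \<noteq> x \<otimes> (g \<otimes> g)"
  shows "eq_or_arc (Delta H G g) x g"
proof (cases "x = g")
  case False
  have g: "g \<in> H" "g \<in> carrier G" and x: "x \<in> carrier G"
    using assms by (auto dest: subgroup.mem_carrier)
  have "g \<noteq> \<one>"
    using assms(1,2) by (auto simp: rel_center_def subgroup.one_closed)
  have "commutator G x g \<noteq> g"
  proof
    assume "commutator G x g = g"
    then have "\<one> \<otimes> (x \<otimes> g) = g \<otimes> (x \<otimes> g)"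
      using g x by (simp add: commutator_eq_iff)
    with g x \<open>g \<noteq> \<one>\<close> show False by (metis m_closed one_closed right_cancel)
  qed
  moreover have "commutator G x g \<noteq> inv g"
  proof
    assume "commutator G x g = inv g"
    then have "x \<otimes> g = g \<otimes> (x \<otimes> inv g)"
      using g x by (simp add: commutator_eq_iff)
    then have "(x \<otimes> g) \<otimes> g = (g \<otimes> (x \<otimes> inv g)) \<otimes> g" by simp
    with g x no_square show False by (simp add: m_assoc)
  qed
  ultimately show ?thesis
    using assms(2,3) g x by (simp add: eq_or_arc_def Delta_def)
qed (simp add: eq_or_arc_def)

text \<open>A central \<open>g\<^sup>2\<close> would be fixed under conjugation, hence equal to its conjugate \<open>g\<close>.\<close>

lemma square_not_rel_central:
  assumes "subgroup H G" "g \<in> H - rel_center H G" "x \<in> carrier G"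
    and square: "g \<otimes> x = x \<otimes> (g \<otimes> g)"
  shows "g \<otimes> g \<in> H - rel_center H G"
proof -
  have g: "g \<in> H" "g \<in> carrier G"
    using assms by (auto dest: subgroup.mem_carrier)
  have "g \<otimes> g \<notin> rel_center H G"
  proof
    assume central: "g \<otimes> g \<in> rel_center H G"
    then have "g \<otimes> x = (g \<otimes> g) \<otimes> x"
      using square assms(3) by (simp add: rel_center_def)
    then have "g = g \<otimes> g" using g assms(3) by simp
    with central assms(2) show False by simp
  qed
  then show ?thesis using assms(1) g by (simp add: subgroup.m_closed)
qed

text \<open>An element that conjugates \<open>g\<close> to \<open>g\<^sup>2\<close> conjugates \<open>g\<^sup>2\<close> to \<open>g\<^sup>4\<close>. Both excluded values
  of \<open>[x, g\<^sup>2]\<close> then give a relation in the powers of \<open>g\<close> alone: \<open>g\<^sup>3 = \<one>\<close> for the value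
  \<open>g\<close>, and \<open>g = \<one>\<close> for the value \<open>g\<inverse>\<close>.\<close>

lemma eq_or_arc_Delta_square:
  assumes "subgroup H G" "g \<in> H - rel_center H G" "ord g \<noteq> 3"
    and "x \<in> carrier G - rel_center H G"
    and square: "g \<otimes> x = x \<otimes> (g \<otimes> g)"
  shows "eq_or_arc (Delta H G g) x (g \<otimes> g)"
proof -
  have g: "g \<in> H" "g \<in> carrier G" and x: "x \<in> carrier G"
    using assms by (auto dest: subgroup.mem_carrier)
  have "g \<noteq> \<one>"
    using assms(1,2) by (auto simp: rel_center_def subgroup.one_closed)
  have "g \<otimes> (g \<otimes> g) \<noteq> \<one>"
  proof
    assume "g \<otimes> (g \<otimes> g) = \<one>"
    then have "g [^] (3 :: nat) = \<one>"
      using g by (simp add: numeral_3_eq_3 m_assoc)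
    then have "ord g dvd 3" using g by (simp add: pow_eq_id)
    moreover have "Factorial_Ring.prime (3 :: nat)" by simp
    ultimately have "ord g = 1 \<or> ord g = 3" by (simp add: prime_nat_iff)
    then show False using assms(3) g \<open>g \<noteq> \<one>\<close> ord_eq_1 by blast
  qed
  have pass: "g \<otimes> (x \<otimes> d) = x \<otimes> (g \<otimes> (g \<otimes> d))" if "d \<in> carrier G" for d
    using square g x that by (metis m_assoc m_closed)
  have fourth: "(g \<otimes> g) \<otimes> (x \<otimes> c) = x \<otimes> (g \<otimes> (g \<otimes> (g \<otimes> (g \<otimes> c))))"
    if "c \<in> carrier G" for c
    using g x that by (simp add: m_assoc pass)
  have reduce: "g \<otimes> (g \<otimes> c) = \<one>"
    if "commutator G x (g \<otimes> g) = c" "c \<in> carrier G" for c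
  proof -
    have "x \<otimes> (g \<otimes> (g \<otimes> \<one>)) = x \<otimes> (g \<otimes> (g \<otimes> (g \<otimes> (g \<otimes> c))))"
      using that g x fourth[of c] by (simp add: commutator_eq_iff)
    then show ?thesis using g x that(2) by (simp del: r_one)
  qed
  have "commutator G x (g \<otimes> g) \<noteq> g"
    using reduce[of g] g \<open>g \<otimes> (g \<otimes> g) \<noteq> \<one>\<close> by auto
  moreover have "commutator G x (g \<otimes> g) \<noteq> inv g"
    using reduce[of "inv g"] g \<open>g \<noteq> \<one>\<close> by auto
  moreover have "x \<noteq> g \<otimes> g"
  proof
    assume "x = g \<otimes> g"
    then have "g \<otimes> (g \<otimes> (g \<otimes> \<one>)) = g \<otimes> (g \<otimes> (g \<otimes> g))"
      using square g by (simp add: m_assoc)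
    then show False using g \<open>g \<noteq> \<one>\<close> by (simp del: r_one)
  qed
  moreover have "g \<otimes> g \<in> H - rel_center H G"
    using square_not_rel_central assms(1,2) square x by blast
  ultimately show ?thesis
    using assms(4) g by (simp add: eq_or_arc_def Delta_def)
qed

lemma eq_or_arc_Delta_self_square:
  assumes "subgroup H G" "g \<in> H - rel_center H G" "g \<otimes> g \<in> H - rel_center H G"
  shows "eq_or_arc (Delta H G g) g (g \<otimes> g)"
proof -
  have g: "g \<in> carrier G" using assms by (auto dest: subgroup.mem_carrier)
  have "g \<noteq> \<one>"
    using assms(1,2) by (auto simp: rel_center_def subgroup.one_closed)
  then have "\<one> \<noteq> inv g" using g inv_eq_1_iff by metis
  moreover have "commutator G g (g \<otimes> g) = \<one>"
    using g by (simp add: commutator_eq_iff m_assoc)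
  ultimately show ?thesis
    using assms g \<open>g \<noteq> \<one>\<close> by (auto simp: eq_or_arc_def Delta_def)
qed

end

theorem theorem3p3:
  fixes G :: "('a, 'b) monoid_scheme" and H :: "'a set" and g :: 'a
  assumes "group G" and "finite (carrier G)" and "\<not> comm_group G"
    and "subgroup H G" and "H \<noteq> rel_center H G"
    and "g \<in> rel_commutators H G"
    and "g \<in> H - rel_center H G" and "group.ord G g \<noteq> 3"
  shows "diameter (with_proj (Delta H G g)) \<le> 3"
proof -
  interpret group G by fact
  let ?D = "Delta H G g" and ?s = "g \<otimes>\<^bsub>G\<^esub> g"
  have g: "g \<in> carrier G" using assms(4,7) by (auto dest: subgroup.mem_carrier)
  interpret D: pair_graph ?D
    using assms(2) g by (rule pair_graph_Delta)
  have sym: "eq_or_arc ?D y x" if "eq_or_arc ?D x y" for x y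
    using that D.sym_arcs by (auto simp: eq_or_arc_def symmetric_def dest: symD)
  have verts: "pverts ?D = carrier G - rel_center H G" by (simp add: Delta_def)
  have g_vert: "g \<in> pverts ?D" using assms(7) g verts by simp
  have near: "eq_or_arc ?D x g
      \<or> eq_or_arc ?D x ?s \<and> ?s \<in> pverts ?D \<and> eq_or_arc ?D g ?s"
    if "x \<in> pverts ?D" for x
  proof (cases "g \<otimes>\<^bsub>G\<^esub> x = x \<otimes>\<^bsub>G\<^esub> ?s")
    case True
    have x: "x \<in> carrier G - rel_center H G" using that verts by simp
    have s: "?s \<in> H - rel_center H G"
      using square_not_rel_central[OF assms(4,7) _ True] x by simp
    then show ?thesis
      using eq_or_arc_Delta_square[OF assms(4,7,8) x True]
        eq_or_arc_Delta_self_square[OF assms(4,7) s] g verts by simp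
  next
    case False
    then show ?thesis using eq_or_arc_Delta_self[OF assms(4,7)] that verts by simp
  qed
  have "D.\<mu> (\<lambda>_. 1) u v \<le> 3" if u: "u \<in> pverts ?D" and v: "v \<in> pverts ?D" for u v
  proof -
    have refl: "eq_or_arc ?D x x" for x by (simp add: eq_or_arc_def)
    obtain a b where "eq_or_arc ?D u a" "eq_or_arc ?D a b" "eq_or_arc ?D b v"
      "a \<in> pverts ?D" "b \<in> pverts ?D"
      using near[OF u] near[OF v] g_vert sym refl by metis
    then show ?thesis using v by (rule D.distance_le_3)
  qed
  then show ?thesis by (auto simp: diameter_def intro!: SUP_least)
qed

end
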